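(* Let $\alpha\in(0,1)$, let $0=t_0<t_1<t_2<\cdots$ be an infinite grid, and consider an arbitrary completely positive discretization $\mathcal{D}_\tau^\alpha$ with kernel $C=(c_{n-j}^n)$. Suppose there is $\nu>0$ such that $$c_{n-j}^n\ \ge\ \nu\,\frac{1}{\tau_j}\int_{t_{j-1}}^{t_j} g_{1-\alpha}(t_n-s)\,ds\qquad\text{for all } n\ge 1,\ 1\le j\le n .$$ Let $(v_n)_{n\ge0}$ be a nonnegative sequence satisfying, for some $\lambda\ge 0$ and some constant $c$, $$\mathcal{D}_\tau^\alpha v_n\le -\lambda v_n+c\qquad\text{for all } n\ge 1 .$$ If $\lambda>0$ and $v_0\le c/\lambda$, then for all $n$ $$v_n\le (v_0-c/\lambda)\,E_\alpha(-\nu^{-1}\lambda t_n^\alpha)+c/\lambda .$$ If $\lambda=0$ and $v_0\ge 0$, then for all $n$ $$v_n\le v_0+\nu^{-1}c\,\frac{1}{\Gamma(1+\alpha)}\,t_n^\alpha .$$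
   Context: $\tau_n:=t_n-t_{n-1}$ (no restriction on step sizes or their ratios). $g_{1-\alpha}(t)=\frac{1}{\Gamma(1-\alpha)}t^{-\alpha}$ for $t>0$. $E_\alpha(z)=\sum_{k\ge0}\frac{z^k}{\Gamma(\alpha k+1)}$ is the Mittag-Leffler function. A kernel is a lower triangular real array $C=(c_{n-j}^n)_{1\le j\le n}$, where $c_{n-j}^n$ is the entry in row $n$ and column $j$. The associated discrete fractional derivative of a real sequence $(u_n)_{n\ge 0}$ is $$\mathcal{D}_\tau^\alpha u_n:=\sum_{j=1}^n c_{n-j}^n\,(u_j-u_{j-1}),\qquad n\ge1 .$$ Put $b_0^n=c_0^n$ and $b_{n-j}^n=c_{n-j}^n-c_{n-j-1}^n$ for $1\le j\le n-1$. The discretization is called completely positive if for all $n\ge1$: $b_0^n>0$, $b_{n-j}^n\le 0$ for all $1\le j<n$, and $\sum_{j=1}^n b_{n-j}^n\ge 0$.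
   Formalization: In the case λ=0 the formal theorem additionally assumes c≥0; for c<0 the stated bound is false (e.g. α=1/2, t_n=n, ν=1, all kernel entries 2, v=(1,0,0,…), c=-2). *)

theory Defs
  imports "HOL-Analysis.Analysis"
begin

definition step_size :: "(nat \<Rightarrow> real) \<Rightarrow> nat \<Rightarrow> real" where
  "step_size t n = t n - t (n - 1)"

text \<open>
  The weight written with subscript \<open>1 - \<alpha>\<close> on paper; it is only meant for positive times.
  In \<open>kernel_lower_bound\<close> it is evaluated at 0 only at the right end point of the last
  interval, a null set.
\<close>
definition frac_weight :: "real \<Rightarrow> real \<Rightarrow> real" where
  "frac_weight \<alpha> s = s powr (- \<alpha>) / Gamma (1 - \<alpha>)"

definition mittag_leffler :: "real \<Rightarrow> real \<Rightarrow> real" where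
  "mittag_leffler \<alpha> z = (\<Sum>k. z ^ k / Gamma (\<alpha> * real k + 1))"

text \<open>
  A kernel is given by its superscript and its subscript: \<open>C n k\<close> is the entry with row
  superscript \<open>n\<close> and subscript \<open>k\<close>, so that row \<open>n\<close>, column \<open>j\<close> of the lower triangular
  array is \<open>C n (n - j)\<close>. Only the values with \<open>n \<ge> 1\<close> and \<open>k < n\<close> matter.
\<close>
definition discrete_frac_deriv ::
    "(nat \<Rightarrow> nat \<Rightarrow> real) \<Rightarrow> (nat \<Rightarrow> real) \<Rightarrow> nat \<Rightarrow> real" where
  "discrete_frac_deriv C u n = (\<Sum>j=1..n. C n (n - j) * (u j - u (j - 1)))"

text \<open>The coefficients \<open>b\<close>, with the same superscript/subscript convention.\<close>
definition kernel_diff :: "(nat \<Rightarrow> nat \<Rightarrow> real) \<Rightarrow> nat \<Rightarrow> nat \<Rightarrow> real" where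
  "kernel_diff C n k = (if k = 0 then C n 0 else C n k - C n (k - 1))"

definition completely_positive :: "(nat \<Rightarrow> nat \<Rightarrow> real) \<Rightarrow> bool" where
  "completely_positive C \<longleftrightarrow>
     (\<forall>n\<ge>1. kernel_diff C n 0 > 0
        \<and> (\<forall>j. 1 \<le> j \<and> j < n \<longrightarrow> kernel_diff C n (n - j) \<le> 0)
        \<and> (\<Sum>j=1..n. kernel_diff C n (n - j)) \<ge> 0)"

definition kernel_lower_bound ::
    "real \<Rightarrow> (nat \<Rightarrow> real) \<Rightarrow> real \<Rightarrow> (nat \<Rightarrow> nat \<Rightarrow> real) \<Rightarrow> bool" where
  "kernel_lower_bound \<alpha> t \<nu> C \<longleftrightarrow>
     (\<forall>n\<ge>1. \<forall>j. 1 \<le> j \<and> j \<le> n \<longrightarrow>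
        C n (n - j) \<ge>
          \<nu> * (1 / step_size t j * integral {t (j - 1)..t j} (\<lambda>s. frac_weight \<alpha> (t n - s))))"

end

theory Submission
  imports Defs
begin

text \<open>
  Write \<open>\<mu> = \<lambda> / \<nu>\<close>. The bounds are the values at \<open>t\<^sub>n\<close> of \<open>w = v\<^sub>0 + A \<Phi>\<close>, where
  \<open>A = (c - \<lambda> v\<^sub>0) / \<nu>\<close> and \<open>\<Phi>' = r\<close> with
  \<open>r(s) = s\<^bsup>\<alpha>-1\<^esup> E\<^bsub>\<alpha>,\<alpha>\<^esub>(-\<mu> s\<^bsup>\<alpha>\<^esup>)\<close>; this \<open>w\<close> solves
  \<open>\<nu> D\<^bsup>\<alpha>\<^esup> w = -\<lambda> w + c\<close> for the Caputo derivative. If \<open>r\<close> is nonnegative and nonincreasing, then on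
  each grid interval Chebyshev's integral inequality for the increasing weight and the decreasing
  \<open>w'\<close> gives \<open>D\<^sub>\<tau> w(t\<^sub>n) \<ge> \<nu> D\<^bsup>\<alpha>\<^esup> w(t\<^sub>n)\<close>, and complete positivity gives a discrete comparison
  principle, so \<open>v\<^sub>n \<le> w(t\<^sub>n)\<close>.

  Monotonicity of \<open>r\<close> follows from \<open>E\<^bsub>\<alpha>,\<alpha>\<^esub>(-x) > 0\<close> and its derivative being negative. Both signs come
  from one continuation argument for Volterra equations \<open>D + k * D = g\<close> with
  \<open>k(s) = s\<^bsup>\<alpha>-1\<^esup> / \<Gamma>(\<alpha>)\<close> and \<open>g / k\<close> nondecreasing: \<open>D\<close> cannot vanish for the first time. It is
  applied first with \<open>g = k\<close>, which gives positivity of \<open>r\<close> (for \<open>\<mu> = 1\<close>), then with \<open>g = k * r = k - r\<close>, where \<open>g / k\<close> is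
  nondecreasing precisely as long as the derivative has kept its sign.
\<close>

section \<open>Growth of the Gamma function and Beta integrals\<close>

text \<open>Keep only the tail \<open>{A..}\<close> of the Gamma integral, where the power is at
  least its value at \<open>A\<close>. As \<open>A\<close> is free, Gamma outgrows every geometric
  sequence.\<close>

lemma powr_exp_le_Gamma:
  fixes A y :: real
  assumes A: "A > 0" and y: "y \<ge> 1"
  shows "A powr (y - 1) * exp (- A) \<le> Gamma y"
proof -
  have "((\<lambda>t. A powr (y - 1) * exp (- 1 * t)) has_integral A powr (y - 1) * (exp (- 1 * A) / 1)) {A..}"
    by (intro has_integral_mult_right has_integral_exp_minus_to_infinity) auto
  then have 1: "((\<lambda>t. if t \<in> {A..} then A powr (y - 1) * exp (- 1 * t) else 0) has_integral
      A powr (y - 1) * (exp (- 1 * A) / 1)) {0..}"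
    by (subst has_integral_restrict) (use A in auto)
  have 2: "((\<lambda>t. t powr (y - 1) / exp t) has_integral Gamma y) {0..}"
    using Gamma_integral_real[of y] y by simp
  have "A powr (y - 1) * (exp (- 1 * A) / 1) \<le> Gamma y"
    by (rule has_integral_le[OF 1 2])
       (use A y in \<open>auto simp: exp_minus divide_inverse intro!: mult_right_mono powr_mono2\<close>)
  then show ?thesis by simp
qed

text \<open>Semigroup law of the fractional integration kernels under convolution: the Beta integral
  rescaled from \<open>{0..1}\<close> to \<open>{0..T}\<close>.\<close>

lemma has_integral_Beta_scaled:
  fixes a b T :: real
  assumes "a > 0" "b > 0" "T > 0"
  shows "((\<lambda>s. (T - s) powr (a - 1) / Gamma a * (s powr (b - 1) / Gamma b)) has_integral
           T powr (a + b - 1) / Gamma (a + b)) {0..T}"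
proof -
  have "((\<lambda>s. s powr (b - 1) * (1 - s) powr (a - 1)) has_integral Beta b a) {0..1}"
    using has_integral_Beta_real[of b a] assms by simp
  from has_integral_stretch_real[OF this, of "1/T"] assms
  have 1: "((\<lambda>s. (s / T) powr (b - 1) * (1 - s / T) powr (a - 1)) has_integral T * Beta b a) {0..T}"
    by (simp add: image_mult_atLeastAtMost_if mult.commute[of _ T])
  have eq: "T powr (a + b - 2) / (Gamma a * Gamma b) * ((s / T) powr (b - 1) * (1 - s / T) powr (a - 1))
      = (T - s) powr (a - 1) / Gamma a * (s powr (b - 1) / Gamma b)" if "s \<in> {0..T}" for s
  proof -
    have "1 - s / T = (T - s) / T" using assms by (simp add: field_simps)
    moreover have "T powr (a + b - 2) = T powr (a - 1) * T powr (b - 1)"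
      by (simp flip: powr_add)
    ultimately show ?thesis
      using that assms by (simp add: powr_divide)
  qed
  have val: "T powr (a + b - 2) / (Gamma a * Gamma b) * (T * Beta b a) = T powr (a + b - 1) / Gamma (a + b)"
  proof -
    have "T powr (a + b - 1) = T powr (a + b - 2) * T"
      using assms powr_add[of T "a + b - 2" 1] by simp
    moreover have "Gamma a \<noteq> 0" "Gamma b \<noteq> 0"
      using assms by (simp_all add: Gamma_real_pos less_imp_neq[symmetric] del: Gamma_eq_zero_iff)
    ultimately show ?thesis
      using assms by (simp add: Beta_def add.commute)
  qed
  from has_integral_mult_right[OF 1, of "T powr (a + b - 2) / (Gamma a * Gamma b)"]
  show ?thesis
    unfolding val by (rule has_integral_eq[rotated]) (rule eq)
qed

section \<open>Convergence of Mittag-Leffler type series and termwise integration\<close>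

lemma summable_ml:
  fixes \<alpha> \<beta> x :: real
  assumes "\<alpha> > 0" "\<beta> > 0"
  shows "summable (\<lambda>k. x ^ k / Gamma (\<alpha> * real k + \<beta>))"
proof -
  \<comment> \<open>Chosen so that the Gamma bound contains
    \<open>(2 * (\<bar>x\<bar> + 1)) ^ k\<close>, which beats the numerator by the factor
    \<open>(1 / 2) ^ k\<close>.\<close>
  define A where "A = (2 * (\<bar>x\<bar> + 1)) powr (1 / \<alpha>)"
  have A: "A > 0" and A\<alpha>: "A powr \<alpha> = 2 * (\<bar>x\<bar> + 1)"
    using assms by (auto simp: A_def powr_powr)
  obtain N where N: "real N \<ge> 1 / \<alpha>" using real_arch_simple by blast
  show ?thesis
  proof (rule summable_comparison_test'[where N = N])
    show "summable (\<lambda>k. exp A * A powr (1 - \<beta>) * (1 / 2) ^ k)"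
      by (intro summable_mult summable_geometric) auto
    fix k assume k: "k \<ge> N"
    have "1 \<le> \<alpha> * real N" using N assms by (simp add: field_simps)
    also have "\<dots> \<le> \<alpha> * real k" using k assms by simp
    finally have y: "\<alpha> * real k + \<beta> \<ge> 1" using assms by simp
    have "A powr (\<alpha> * real k + \<beta> - 1) = (A powr \<alpha>) ^ k * A powr (\<beta> - 1)"
      using A by (simp add: powr_add[symmetric] powr_powr powr_realpow[symmetric] algebra_simps)
    then have G: "(2 * (\<bar>x\<bar> + 1)) ^ k * A powr (\<beta> - 1) * exp (- A) \<le> Gamma (\<alpha> * real k + \<beta>)"
      using powr_exp_le_Gamma[OF A y] A\<alpha> by simp
    have pos: "0 < (2 * (\<bar>x\<bar> + 1)) ^ k * A powr (\<beta> - 1) * exp (- A)"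
      using A by (intro mult_pos_pos zero_less_power) auto
    have "norm (x ^ k / Gamma (\<alpha> * real k + \<beta>)) = \<bar>x\<bar> ^ k / Gamma (\<alpha> * real k + \<beta>)"
      using less_le_trans[OF pos G] by (simp add: power_abs)
    also have "\<dots> \<le> (\<bar>x\<bar> + 1) ^ k / ((2 * (\<bar>x\<bar> + 1)) ^ k * A powr (\<beta> - 1) * exp (- A))"
      using G pos by (intro frac_le power_mono) auto
    also have "\<dots> = exp A * A powr (1 - \<beta>) * (1 / 2) ^ k"
      using A unfolding power_mult_distrib[of 2] by (simp add: exp_minus powr_diff power_one_over divide_simps)
    finally show "norm (x ^ k / Gamma (\<alpha> * real k + \<beta>)) \<le> exp A * A powr (1 - \<beta>) * (1 / 2) ^ k" .
  qed
qed

lemma summable_ml_coeff: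
  fixes \<alpha> \<beta> x M :: real and a :: "nat \<Rightarrow> real"
  assumes "\<alpha> > 0" "\<beta> > 0" "\<And>k. \<bar>a k\<bar> \<le> M ^ k"
  shows "summable (\<lambda>k. \<bar>a k * x ^ k / Gamma (\<alpha> * real k + \<beta>)\<bar>)"
proof (rule summable_comparison_test')
  show "summable (\<lambda>k. (M * \<bar>x\<bar>) ^ k / Gamma (\<alpha> * real k + \<beta>))"
    using assms by (intro summable_ml)
  fix k :: nat assume "k \<ge> 0"
  have "Gamma (\<alpha> * real k + \<beta>) > 0" using assms by (intro Gamma_real_pos add_nonneg_pos) auto
  then show "norm \<bar>a k * x ^ k / Gamma (\<alpha> * real k + \<beta>)\<bar> \<le> (M * \<bar>x\<bar>) ^ k / Gamma (\<alpha> * real k + \<beta>)"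
    using assms(3)[of k] by (simp add: abs_mult power_abs power_mult_distrib divide_right_mono mult_right_mono)
qed

text \<open>Termwise integration by summability of the L1 norms \<open>J k\<close>: the gauge
  integrals are absolutely convergent, so the Lebesgue theorem on series applies.\<close>

lemma has_integral_suminf:
  fixes f :: "nat \<Rightarrow> real \<Rightarrow> real"
  assumes f: "\<And>k. (f k has_integral I k) S"
    and abs: "\<And>k. ((\<lambda>x. \<bar>f k x\<bar>) has_integral J k) S"
    and S: "S \<in> sets lebesgue"
    and sm: "\<And>x. x \<in> S \<Longrightarrow> summable (\<lambda>k. \<bar>f k x\<bar>)"
    and J: "summable J"
  shows "((\<lambda>x. \<Sum>k. f k x) has_integral (\<Sum>k. I k)) S"
proof -
  have ai: "f k absolutely_integrable_on S" for k
    using f abs by (auto simp: absolutely_integrable_on_def integrable_on_def)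
  have int: "integrable (lebesgue_on S) (f k)" for k
    using ai S by (simp add: integrable_restrict_space set_integrable_def)
  have I: "integral\<^sup>L (lebesgue_on S) (f k) = I k" for k
    using lebesgue_integral_eq_integral[OF int S] f by (simp add: integral_unique)
  have Jk: "integral\<^sup>L (lebesgue_on S) (\<lambda>x. norm (f k x)) = J k" for k
    using lebesgue_integral_eq_integral[OF integrable_norm[OF int] S] abs by (simp add: integral_unique)
  have sum: "AE x in lebesgue_on S. summable (\<lambda>k. norm (f k x))"
    using sm S by (intro AE_I2) (simp add: space_restrict_space)
  have J': "summable (\<lambda>k. integral\<^sup>L (lebesgue_on S) (\<lambda>x. norm (f k x)))"
    using J by (simp only: Jk)
  have "((\<lambda>x. \<Sum>k. f k x) has_integral integral\<^sup>L (lebesgue_on S) (\<lambda>x. \<Sum>k. f k x)) S"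
    by (rule has_integral_integral_lebesgue_on[OF integrable_suminf[OF int sum J'] S])
  also have "integral\<^sup>L (lebesgue_on S) (\<lambda>x. \<Sum>k. f k x) = (\<Sum>k. I k)"
    using integral_suminf[OF int sum J'] by (simp only: I)
  finally show ?thesis .
qed

section \<open>Fractional integration of power series\<close>

text \<open>With \<open>a k = (-\<mu>) ^ k\<close> and \<open>s > 0\<close>, \<beta> = 1 gives
  E_\<alpha>(-\<mu> s^\<alpha>) and \<beta> = \<alpha> gives the resolvent r(s). Since
  \<open>0 powr x = 0\<close> for every \<open>x\<close>, the value at \<open>s = 0\<close> is 0
  even for \<beta> = 1.\<close>

definition frac_series :: "real \<Rightarrow> real \<Rightarrow> (nat \<Rightarrow> real) \<Rightarrow> real \<Rightarrow> real" where
  "frac_series \<alpha> \<beta> a s = (\<Sum>k. a k * (s powr (\<alpha> * real k + \<beta> - 1) / Gamma (\<alpha> * real k + \<beta>)))"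

lemma powr_arith_progression:
  fixes s \<alpha> \<beta> :: real
  assumes "s > 0"
  shows "s powr (\<alpha> * real k + \<beta> - 1) = s powr (\<beta> - 1) * (s powr \<alpha>) ^ k"
  using assms by (simp add: powr_add[symmetric] powr_powr powr_realpow[symmetric] algebra_simps)

lemma frac_series_eq:
  assumes "\<alpha> > 0" "\<beta> > 0" "\<And>k. \<bar>a k\<bar> \<le> M ^ k" "s > 0"
  shows "frac_series \<alpha> \<beta> a s = s powr (\<beta> - 1) * (\<Sum>k. a k / Gamma (\<alpha> * real k + \<beta>) * (s powr \<alpha>) ^ k)"
proof -
  have "summable (\<lambda>k. a k / Gamma (\<alpha> * real k + \<beta>) * (s powr \<alpha>) ^ k)"
    using summable_rabs_cancel[OF summable_ml_coeff[OF assms(1-3)]] by simp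
  from suminf_mult[OF this, of "s powr (\<beta> - 1)"] show ?thesis
    using assms by (simp add: frac_series_def powr_arith_progression mult_ac)
qed

lemma summable_frac_series:
  assumes "\<alpha> > 0" "\<beta> > 0" "\<And>k. \<bar>a k\<bar> \<le> M ^ k" "s \<ge> 0"
  shows "summable (\<lambda>k. \<bar>a k * (s powr (\<alpha> * real k + \<beta> - 1) / Gamma (\<alpha> * real k + \<beta>))\<bar>)"
proof (cases "s = 0")
  case False
  then have "s > 0" using assms by simp
  have "summable (\<lambda>k. s powr (\<beta> - 1) * \<bar>a k * (s powr \<alpha>) ^ k / Gamma (\<alpha> * real k + \<beta>)\<bar>)"
    by (intro summable_mult summable_ml_coeff[OF assms(1-3)])
  then show ?thesis
    using \<open>s > 0\<close> by (simp add: powr_arith_progression abs_mult mult_ac)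
qed auto

text \<open>Fractional integration of order \<gamma> acts on each term by the Beta integral and so
  just adds \<gamma> to \<beta>. This yields the Volterra equations, the antiderivative of r and its
  Caputo-type integral.\<close>

lemma has_integral_frac_series:
  fixes \<alpha> \<beta> \<gamma> T :: real
  assumes "\<alpha> > 0" "\<beta> > 0" "\<gamma> > 0" "T > 0" and a: "\<And>k. \<bar>a k\<bar> \<le> M ^ k"
  shows "((\<lambda>s. (T - s) powr (\<gamma> - 1) / Gamma \<gamma> * frac_series \<alpha> \<beta> a s) has_integral
           frac_series \<alpha> (\<gamma> + \<beta>) a T) {0..T}"
proof -
  define f where "f = (\<lambda>k s. a k * ((T - s) powr (\<gamma> - 1) / Gamma \<gamma> *
     (s powr (\<alpha> * real k + \<beta> - 1) / Gamma (\<alpha> * real k + \<beta>))))"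
  define I where "I = (\<lambda>k. T powr (\<alpha> * real k + (\<gamma> + \<beta>) - 1) / Gamma (\<alpha> * real k + (\<gamma> + \<beta>)))"
  have pos: "\<alpha> * real k + \<beta> > 0" "\<alpha> * real k + (\<gamma> + \<beta>) > 0" for k
    using assms by (auto intro!: add_nonneg_pos)
  have f: "(f k has_integral a k * I k) {0..T}" for k
    using has_integral_mult_right[OF has_integral_Beta_scaled[OF \<open>\<gamma> > 0\<close> pos(1)[of k] \<open>T > 0\<close>], of "a k"]
    by (simp add: f_def I_def add_ac)
  \<comment> \<open>The kernels are nonnegative, so the same Beta integral computes the L1
    norm.\<close>
  have absf: "\<bar>f k s\<bar> = \<bar>a k\<bar> * ((T - s) powr (\<gamma> - 1) / Gamma \<gamma> *
     (s powr (\<alpha> * real k + \<beta> - 1) / Gamma (\<alpha> * real k + \<beta>)))" for k s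
    using Gamma_real_pos[OF pos(1)[of k]] Gamma_real_pos[OF \<open>\<gamma> > 0\<close>] by (simp add: f_def abs_mult)
  have J: "((\<lambda>s. \<bar>f k s\<bar>) has_integral \<bar>a k\<bar> * I k) {0..T}" for k
    unfolding absf
    using has_integral_mult_right[OF has_integral_Beta_scaled[OF \<open>\<gamma> > 0\<close> pos(1)[of k] \<open>T > 0\<close>], of "\<bar>a k\<bar>"]
    by (simp add: I_def add_ac)
  have fs: "f k s = (T - s) powr (\<gamma> - 1) / Gamma \<gamma> *
      (a k * (s powr (\<alpha> * real k + \<beta> - 1) / Gamma (\<alpha> * real k + \<beta>)))" for k s
    by (simp add: f_def)
  have "((\<lambda>s. \<Sum>k. f k s) has_integral (\<Sum>k. a k * I k)) {0..T}"
  proof (rule has_integral_suminf[OF f J])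
    fix s assume "s \<in> {0..T}"
    then show "summable (\<lambda>k. \<bar>f k s\<bar>)"
      unfolding fs abs_mult[of "(T - s) powr (\<gamma> - 1) / Gamma \<gamma>"]
      using assms by (intro summable_mult summable_frac_series[OF _ _ a]) auto
  next
    have "\<bar>a k\<bar> * I k = \<bar>a k * I k\<bar>" for k
      using Gamma_real_pos[OF pos(2)[of k]] by (simp add: I_def abs_mult)
    then show "summable (\<lambda>k. \<bar>a k\<bar> * I k)"
      using summable_frac_series[OF \<open>\<alpha> > 0\<close> _ a, of "\<gamma> + \<beta>" T] assms by (simp add: I_def)
  qed auto
  moreover have "(\<Sum>k. f k s) = (T - s) powr (\<gamma> - 1) / Gamma \<gamma> * frac_series \<alpha> \<beta> a s"
    if "s \<in> {0..T}" for s
    unfolding fs frac_series_def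
    by (intro suminf_mult summable_rabs_cancel[OF summable_frac_series[OF _ _ a]]) (use assms that in auto)
  ultimately show ?thesis
    unfolding frac_series_def[of \<alpha> "\<gamma> + \<beta>"] I_def
    by (rule has_integral_eq[rotated])
qed

section \<open>A positivity principle for Volterra equations\<close>

text \<open>
  The equation at time \<open>t < T\<close> controls the part of the convolution at time \<open>T\<close> over \<open>[0, t]\<close>, because
  \<open>k (T - s) / k (t - s) \<le> k T / k t\<close>. Taking \<open>t\<close> to be a maximum point of \<open>D\<close> on a short interval
  \<open>[T - \<delta>, T]\<close> makes the remaining part over \<open>[t, T]\<close> small compared with \<open>D t\<close>.
\<close>
lemma volterra_positive_step:
  fixes D g :: "real \<Rightarrow> real" and \<alpha> T :: real
  defines "k \<equiv> (\<lambda>s::real. s powr (\<alpha> - 1) / Gamma \<alpha>)"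
  assumes \<alpha>: "0 < \<alpha>" "\<alpha> < 1" and T: "T > 0"
    and cont: "continuous_on {0<..T} D"
    and pos: "\<And>s. 0 < s \<Longrightarrow> s < T \<Longrightarrow> D s > 0"
    and eq: "\<And>t. 0 < t \<Longrightarrow> t \<le> T \<Longrightarrow> ((\<lambda>s. k (t - s) * D s) has_integral g t - D t) {0..t}"
    and mono: "\<And>t. 0 < t \<Longrightarrow> t \<le> T \<Longrightarrow> g t / k t \<le> g T / k T"
  shows "D T > 0"
proof -
  have \<Gamma>: "Gamma \<alpha> > 0" "Gamma (\<alpha> + 1) > 0" using \<alpha> by (auto intro: Gamma_real_pos)
  have "\<alpha> \<notin> \<int>\<^sub>\<le>\<^sub>0" using \<alpha> by (auto dest: nonpos_Ints_nonpos)
  then have \<Gamma>1: "Gamma (\<alpha> + 1) = \<alpha> * Gamma \<alpha>" by (rule Gamma_plus1)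
  \<comment> \<open>The first bound keeps \<open>t \<ge> T / 2\<close>, hence
    \<open>q \<ge> 1 / 2\<close> below; the second makes the integral of \<open>k\<close> over
    \<open>{0..\<delta>}\<close> at most 1/4.\<close>
  define \<delta> where "\<delta> = min (T / 2) ((Gamma (\<alpha> + 1) / 4) powr (1 / \<alpha>))"
  have \<delta>: "0 < \<delta>" "\<delta> \<le> T / 2" using T \<Gamma> by (auto simp: \<delta>_def)
  have "\<delta> powr \<alpha> \<le> ((Gamma (\<alpha> + 1) / 4) powr (1 / \<alpha>)) powr \<alpha>"
    using \<delta> \<alpha> by (intro powr_mono2) (auto simp: \<delta>_def)
  then have \<delta>\<alpha>: "\<delta> powr \<alpha> \<le> Gamma (\<alpha> + 1) / 4"
    using \<alpha> \<Gamma> by (simp add: powr_powr)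
  have "compact {T - \<delta>..T}" "{T - \<delta>..T} \<noteq> {}" "continuous_on {T - \<delta>..T} D"
    using \<delta> T by (auto intro: continuous_on_subset[OF cont])
  from continuous_attains_sup[OF this] obtain t
    where t: "T - \<delta> \<le> t" "t \<le> T" and max: "\<And>s. T - \<delta> \<le> s \<Longrightarrow> s \<le> T \<Longrightarrow> D s \<le> D t" by auto
  have "D (T - \<delta>) > 0" using \<delta> T by (intro pos) auto
  then have Dt: "D t > 0" using max[of "T - \<delta>"] \<delta> by simp
  show ?thesis
  proof (cases "t = T")
    case False
    have t0: "0 < t" "t < T" using t \<delta> T False by auto
    define q where "q = k T / k t"
    have kpos: "k s > 0" if "s > 0" for s using that \<Gamma> by (simp add: k_def)
    have q: "q \<ge> 1 / 2"
    proof -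
      have "q = (t / T) powr (1 - \<alpha>)"
        using t0 T \<Gamma> by (simp add: q_def k_def powr_divide powr_diff field_simps)
      moreover have "(t / T) powr 1 \<le> (t / T) powr (1 - \<alpha>)"
        using t0 T \<alpha> by (intro powr_mono') auto
      moreover have "t / T \<ge> 1 / 2" using t \<delta> T by (simp add: field_simps)
      ultimately show ?thesis using t0 T by (simp only: powr_one divide_nonneg_nonneg less_imp_le)
    qed
    have intT: "(\<lambda>s. k (T - s) * D s) integrable_on {0..T}" using eq[of T] T by auto
    have int1: "(\<lambda>s. k (T - s) * D s) integrable_on {0..t}"
      by (rule integrable_subinterval_real[OF intT]) (use t0 in auto)
    have int2: "(\<lambda>s. k (T - s) * D s) integrable_on {t..T}"
      by (rule integrable_subinterval_real[OF intT]) (use t0 in auto)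
    have split: "integral {0..t} (\<lambda>s. k (T - s) * D s) + integral {t..T} (\<lambda>s. k (T - s) * D s) = g T - D T"
      using Henstock_Kurzweil_Integration.integral_combine[OF _ _ intT, of t] t0 eq[of T] T
      by (simp add: integral_unique)
    have I1: "integral {0..t} (\<lambda>s. k (T - s) * D s) \<le> q * (g t - D t)"
    proof -
      \<comment> \<open>The comparison is made on the open interval: the sign of \<open>D 0\<close>
        is unknown, and at \<open>s = t\<close> it would fail because
        \<open>k 0 = 0\<close>.\<close>
      have i: "((\<lambda>s. q * (k (t - s) * D s)) has_integral q * (g t - D t)) {0<..<t}"
        using has_integral_mult_right[OF eq[of t]] t0 by (simp add: has_integral_Icc_iff_Ioo)
      have i': "((\<lambda>s. k (T - s) * D s) has_integral integral {0..t} (\<lambda>s. k (T - s) * D s)) {0<..<t}"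
        using integrable_integral[OF int1] by (simp add: has_integral_Icc_iff_Ioo)
      show ?thesis
      proof (rule has_integral_le[OF i' i])
        fix s assume s: "s \<in> {0<..<t}"
        \<comment> \<open>Here \<open>(T - s) * t - T * (t - s) = s * (T - t) \<ge> 0\<close>, and
          the exponent is negative.\<close>
        have "((T - s) * t) powr (\<alpha> - 1) \<le> (T * (t - s)) powr (\<alpha> - 1)"
          using s t0 \<alpha> by (intro powr_mono2') (auto simp: algebra_simps)
        then have "(T - s) powr (\<alpha> - 1) * t powr (\<alpha> - 1) \<le> T powr (\<alpha> - 1) * (t - s) powr (\<alpha> - 1)"
          using s t0 by (simp only: powr_mult)
        moreover have "t powr (\<alpha> - 1) > 0" using t0 by simp
        ultimately have "k (T - s) \<le> q * k (t - s)"
          using \<Gamma>(1) unfolding q_def k_def by (simp add: divide_simps mult_ac)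
        then show "k (T - s) * D s \<le> q * (k (t - s) * D s)"
          using pos[of s] s t0 by (simp add: mult.assoc[symmetric] mult_right_mono)
      qed
    qed
    have I2: "integral {t..T} (\<lambda>s. k (T - s) * D s) \<le> D t * ((T - t) powr \<alpha> / Gamma (\<alpha> + 1))"
    proof -
      have "((\<lambda>s. s powr (\<alpha> - 1)) has_integral (T - t) powr \<alpha> / \<alpha>) {0..T - t}"
        using has_integral_powr_from_0[of "\<alpha> - 1" "T - t"] \<alpha> t0 by simp
      from has_integral_affinity[of "\<lambda>s. s powr (\<alpha> - 1)" _ 0 "T - t" "- 1" T, simplified, OF this]
      have "((\<lambda>s. (T - s) powr (\<alpha> - 1)) has_integral (T - t) powr \<alpha> / \<alpha>) {t..T}"
        by simp
      from has_integral_mult_right[OF this, of "D t / Gamma \<alpha>"]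
      have i: "((\<lambda>s. D t * k (T - s)) has_integral D t * ((T - t) powr \<alpha> / Gamma (\<alpha> + 1))) {t..T}"
        using \<Gamma>1 by (simp add: k_def mult_ac)
      show ?thesis
        by (rule has_integral_le[OF integrable_integral[OF int2] i])
           (use max t \<Gamma> in \<open>auto simp: k_def mult.commute[of "D t"] intro!: mult_left_mono divide_right_mono\<close>)
    qed
    have "(T - t) powr \<alpha> \<le> \<delta> powr \<alpha>" using t t0 \<alpha> by (intro powr_mono2) auto
    with \<delta>\<alpha> have small: "(T - t) powr \<alpha> / Gamma (\<alpha> + 1) \<le> 1 / 4" using \<Gamma> by (simp add: field_simps)
    \<comment> \<open>This is the monotonicity of \<open>g / k\<close>; it leaves \<open>D T\<close>
      bounded below by \<open>D t / 4\<close>.\<close>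
    have "q * g t \<le> g T"
      using mono[of t] t0 kpos[of t] kpos[of T] T by (simp add: q_def field_simps)
    then have "D T \<ge> q * D t - D t * ((T - t) powr \<alpha> / Gamma (\<alpha> + 1))"
      using split I1 I2 by (simp add: algebra_simps)
    also have "q * D t - D t * ((T - t) powr \<alpha> / Gamma (\<alpha> + 1)) \<ge> 1 / 2 * D t - D t * (1 / 4)"
      using q small Dt by (intro diff_mono mult_right_mono mult_left_mono) auto
    finally show ?thesis using Dt by simp
  qed (use Dt in auto)
qed

text \<open>If \<open>h\<close> failed to be positive, the closed set where \<open>h \<le> 0\<close>
  would have a least element; it is not 0 by \<open>h0\<close>, and \<open>step\<close> excludes it
  otherwise.\<close>

lemma positive_by_continuation:
  fixes h :: "real \<Rightarrow> real"
  assumes cont: "continuous_on {0..} h" and h0: "h 0 > 0"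
    and step: "\<And>X. X > 0 \<Longrightarrow> (\<And>x. 0 \<le> x \<Longrightarrow> x < X \<Longrightarrow> h x > 0) \<Longrightarrow> h X > 0"
    and "x \<ge> 0"
  shows "h x > 0"
proof (rule ccontr)
  assume "\<not> h x > 0"
  define S where "S = {y \<in> {0..}. h y \<le> 0}"
  have S: "S \<noteq> {}" "bdd_below S" using \<open>\<not> h x > 0\<close> \<open>x \<ge> 0\<close> by (auto simp: S_def bdd_below_def)
  have "closed S"
    using continuous_closed_preimage[OF cont closed_atLeast closed_atMost[of 0]]
    by (simp add: S_def vimage_def Int_def)
  then have "Inf S \<in> S" using S by (intro closed_contains_Inf)
  then have X: "Inf S \<ge> 0" "h (Inf S) \<le> 0" by (auto simp: S_def)
  have "h y > 0" if "0 \<le> y" "y < Inf S" for y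
    using that cInf_lower[of y S] S by (force simp: S_def)
  with step[of "Inf S"] X h0 show False by (cases "Inf S = 0") auto
qed

section \<open>Sign and monotonicity of the Mittag-Leffler resolvent\<close>

text \<open>An index shift is traded for \<beta> + \<alpha>. Since that is also the effect of
  fractional integration of order \<alpha>, recurrences for \<open>a\<close> become Volterra
  equations.\<close>

lemma frac_series_split_head:
  assumes "\<alpha> > 0" "\<beta> > 0" "\<And>k. \<bar>a k\<bar> \<le> M ^ k" "s \<ge> 0"
  shows "frac_series \<alpha> \<beta> a s = a 0 * (s powr (\<beta> - 1) / Gamma \<beta>) + frac_series \<alpha> (\<alpha> + \<beta>) (\<lambda>k. a (Suc k)) s"
proof -
  have "summable (\<lambda>k. a k * (s powr (\<alpha> * real k + \<beta> - 1) / Gamma (\<alpha> * real k + \<beta>)))"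
    by (rule summable_rabs_cancel[OF summable_frac_series[OF assms]])
  from suminf_split_head[OF this] show ?thesis
    by (simp add: frac_series_def algebra_simps)
qed

lemma frac_series_minus: "frac_series \<alpha> \<beta> (\<lambda>k. - a k) s = - frac_series \<alpha> \<beta> a s"
  if "\<alpha> > 0" "\<beta> > 0" "\<And>k. \<bar>a k\<bar> \<le> M ^ k" "s \<ge> 0"
  using suminf_minus[OF summable_rabs_cancel[OF summable_frac_series[OF that]]]
  by (simp add: frac_series_def)

lemma frac_series_cmult: "frac_series \<alpha> \<beta> (\<lambda>k. c * a k) s = c * frac_series \<alpha> \<beta> a s"
  if "\<alpha> > 0" "\<beta> > 0" "\<And>k. \<bar>a k\<bar> \<le> M ^ k" "s \<ge> 0"
  using suminf_mult[OF summable_rabs_cancel[OF summable_frac_series[OF that]], of c]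
  by (simp add: frac_series_def mult_ac)

lemma frac_series_add: "frac_series \<alpha> \<beta> (\<lambda>k. a k + b k) s = frac_series \<alpha> \<beta> a s + frac_series \<alpha> \<beta> b s"
  if "\<alpha> > 0" "\<beta> > 0" "\<And>k. \<bar>a k\<bar> \<le> M ^ k" "\<And>k. \<bar>b k\<bar> \<le> N ^ k" "s \<ge> 0"
  using suminf_add[OF summable_rabs_cancel[OF summable_frac_series[OF that(1,2,3,5)]]
      summable_rabs_cancel[OF summable_frac_series[OF that(1,2,4,5)]]]
  by (simp add: frac_series_def distrib_right add_divide_distrib)

lemma summable_ml_power_series:
  fixes x :: real
  assumes "\<alpha> > 0" "\<beta> > 0" "\<And>k. \<bar>a k\<bar> \<le> M ^ k"
  shows "summable (\<lambda>k. a k / Gamma (\<alpha> * real k + \<beta>) * x ^ k)"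
  using summable_rabs_cancel[OF summable_ml_coeff[OF assms]] by simp

lemma DERIV_ml_power_series:
  fixes x :: real
  assumes "\<alpha> > 0" "\<beta> > 0" "\<And>k. \<bar>a k\<bar> \<le> M ^ k"
  shows "((\<lambda>x. \<Sum>k. a k / Gamma (\<alpha> * real k + \<beta>) * x ^ k) has_real_derivative
           (\<Sum>k. real (Suc k) * a (Suc k) / Gamma (\<alpha> * real k + (\<alpha> + \<beta>)) * x ^ k)) (at x)"
  using termdiffs_strong_converges_everywhere[OF summable_ml_power_series[OF assms], of x]
  by (simp add: diffs_def algebra_simps)

lemma continuous_on_ml_power_series:
  fixes S :: "real set"
  assumes "\<alpha> > 0" "\<beta> > 0" "\<And>k. \<bar>a k\<bar> \<le> M ^ k"
  shows "continuous_on S (\<lambda>x. \<Sum>k. a k / Gamma (\<alpha> * real k + \<beta>) * x ^ k)"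
  by (intro continuous_at_imp_continuous_on ballI DERIV_isCont[OF DERIV_ml_power_series[OF assms]])

text \<open>In the usual notation, \<open>ml_resolvent \<alpha> x\<close> is \<open>E\<^bsub>\<alpha>,\<alpha>\<^esub>(-x)\<close>.\<close>
definition ml_resolvent :: "real \<Rightarrow> real \<Rightarrow> real" where
  "ml_resolvent \<alpha> x = (\<Sum>k. (- 1) ^ k / Gamma (\<alpha> * real k + \<alpha>) * x ^ k)"

text \<open>Minus the derivative of \<open>ml_resolvent\<close>, so that the claim about it is
  positivity; it is the Prabhakar function with upper parameter 2 and lower parameters \<alpha>,
  2\<alpha>, at \<open>-x\<close>.\<close>

definition ml_resolvent_slope :: "real \<Rightarrow> real \<Rightarrow> real" where
  "ml_resolvent_slope \<alpha> x = (\<Sum>k. (- 1) ^ k * real (Suc k) / Gamma (\<alpha> * real k + 2 * \<alpha>) * x ^ k)"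

lemma Suc_le_two_power: "\<bar>(- 1) ^ k * real (Suc k)\<bar> \<le> 2 ^ k"
proof -
  have "Suc k \<le> 2 ^ k" by (induction k) auto
  then have "real (Suc k) \<le> 2 ^ k" by (metis of_nat_le_iff of_nat_numeral of_nat_power)
  then show ?thesis by (simp add: abs_mult)
qed

lemma DERIV_ml_resolvent:
  assumes "\<alpha> > 0"
  shows "(ml_resolvent \<alpha> has_real_derivative - ml_resolvent_slope \<alpha> x) (at x)"
proof -
  have "summable (\<lambda>k. (- 1) ^ k * real (Suc k) / Gamma (\<alpha> * real k + 2 * \<alpha>) * x ^ k)"
    using assms Suc_le_two_power by (intro summable_ml_power_series[where M = 2]) auto
  from suminf_minus[OF this]
  have "(\<Sum>k. real (Suc k) * (- 1) ^ Suc k / Gamma (\<alpha> * real k + (\<alpha> + \<alpha>)) * x ^ k) = - ml_resolvent_slope \<alpha> x"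
    by (simp add: ml_resolvent_slope_def mult_ac)
  then show ?thesis
    using DERIV_ml_power_series[of \<alpha> \<alpha> "\<lambda>k. (- 1) ^ k" 1 x] assms
    by (simp add: ml_resolvent_def[abs_def])
qed

text \<open>For \<mu> = 1 the resolvent solves D + k * D = k, so \<open>g / k\<close> is constant
  and the Volterra step applies at every candidate for a first zero.\<close>

lemma ml_resolvent_pos:
  assumes \<alpha>: "0 < \<alpha>" "\<alpha> < 1" and x: "x \<ge> 0"
  shows "ml_resolvent \<alpha> x > 0"
proof (rule positive_by_continuation[OF _ _ _ x])
  show cont: "continuous_on {0..} (ml_resolvent \<alpha>)"
    by (intro continuous_at_imp_continuous_on ballI DERIV_isCont[OF DERIV_ml_resolvent[OF \<alpha>(1)]])
  show "ml_resolvent \<alpha> 0 > 0"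
    using \<alpha> powser_zero[of "\<lambda>k. (- 1) ^ k / Gamma (\<alpha> * real k + \<alpha>)"] by (simp add: ml_resolvent_def Gamma_real_pos)
  fix X :: real assume X: "X > 0" and pos: "\<And>y. 0 \<le> y \<Longrightarrow> y < X \<Longrightarrow> ml_resolvent \<alpha> y > 0"
  \<comment> \<open>Under \<open>x = s powr \<alpha>\<close>, positivity of
    \<open>ml_resolvent\<close> below \<open>X\<close> is positivity of \<open>D\<close> on the open
    interval from 0 to \<open>T\<close>.\<close>
  define T where "T = X powr (1 / \<alpha>)"
  have T: "T > 0" "T powr \<alpha> = X" using X \<alpha> by (auto simp: T_def powr_powr)
  define D where "D = frac_series \<alpha> \<alpha> (\<lambda>k. (- 1) ^ k)"
  have D: "D s = s powr (\<alpha> - 1) * ml_resolvent \<alpha> (s powr \<alpha>)" if "s > 0" for s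
    unfolding D_def ml_resolvent_def using frac_series_eq[of \<alpha> \<alpha> "\<lambda>k. (- 1) ^ k" 1 s] that \<alpha> by simp
  have "D T > 0"
  proof (rule volterra_positive_step[OF \<alpha> T(1), where g = "\<lambda>s. s powr (\<alpha> - 1) / Gamma \<alpha>"])
    have "continuous_on {0<..T} (\<lambda>s. s powr (\<alpha> - 1) * ml_resolvent \<alpha> (s powr \<alpha>))"
      by (intro continuous_intros continuous_on_compose2[OF cont]) auto
    then show "continuous_on {0<..T} D"
      by (rule continuous_on_eq) (simp add: D)
    show "D s > 0" if "0 < s" "s < T" for s
    proof -
      have "s powr \<alpha> < X" using powr_less_mono2[of \<alpha> s T] that \<alpha> T by simp
      then show ?thesis using that pos[of "s powr \<alpha>"] by (simp add: D)
    qed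
    show "((\<lambda>s. (t - s) powr (\<alpha> - 1) / Gamma \<alpha> * D s) has_integral t powr (\<alpha> - 1) / Gamma \<alpha> - D t) {0..t}"
      if "0 < t" "t \<le> T" for t
    proof -
      have "D t = t powr (\<alpha> - 1) / Gamma \<alpha> - frac_series \<alpha> (\<alpha> + \<alpha>) (\<lambda>k. (- 1) ^ k) t"
        using frac_series_split_head[of \<alpha> \<alpha> "\<lambda>k. (- 1) ^ k" 1 t] that \<alpha>
          frac_series_minus[of \<alpha> "\<alpha> + \<alpha>" "\<lambda>k. (- 1) ^ k" 1 t]
        by (simp add: D_def)
      then show ?thesis
        using has_integral_frac_series[of \<alpha> \<alpha> \<alpha> t "\<lambda>k. (- 1) ^ k" 1] that \<alpha> by (simp add: D_def)
    qed
  qed (use T \<alpha> in auto)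
  then show "ml_resolvent \<alpha> X > 0" using D[OF T(1)] T by (simp add: zero_less_mult_iff)
qed

text \<open>Here D + k * D = k - r, and (k - r) / k = 1 - \<Gamma>(\<alpha>) E(s^\<alpha>) with E =
  \<open>ml_resolvent\<close>. This is nondecreasing up to \<open>T\<close> because the slope is
  positive before \<open>X\<close>, which is what the continuation argument supplies.\<close>

lemma ml_resolvent_slope_pos:
  assumes \<alpha>: "0 < \<alpha>" "\<alpha> < 1" and x: "x \<ge> 0"
  shows "ml_resolvent_slope \<alpha> x > 0"
proof (rule positive_by_continuation[OF _ _ _ x])
  show cont: "continuous_on {0..} (ml_resolvent_slope \<alpha>)"
    unfolding ml_resolvent_slope_def[abs_def]
    using \<alpha> Suc_le_two_power by (intro continuous_on_ml_power_series[where M = 2]) auto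
  show "ml_resolvent_slope \<alpha> 0 > 0"
    using \<alpha> powser_zero[of "\<lambda>k. (- 1) ^ k * real (Suc k) / Gamma (\<alpha> * real k + 2 * \<alpha>)"]
    by (simp add: ml_resolvent_slope_def Gamma_real_pos)
  fix X :: real assume X: "X > 0" and pos: "\<And>y. 0 \<le> y \<Longrightarrow> y < X \<Longrightarrow> ml_resolvent_slope \<alpha> y > 0"
  define T where "T = X powr (1 / \<alpha>)"
  have T: "T > 0" "T powr \<alpha> = X" using X \<alpha> by (auto simp: T_def powr_powr)
  have \<Gamma>: "Gamma \<alpha> > 0" using \<alpha> by (simp add: Gamma_real_pos)
  define b where "b = (\<lambda>k. (- 1) ^ k * real (Suc k))"
  have b: "\<bar>b k\<bar> \<le> 2 ^ k" for k using Suc_le_two_power by (simp add: b_def)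
  define D where "D = frac_series \<alpha> (2 * \<alpha>) b"
  define g where "g = (\<lambda>s. s powr (\<alpha> - 1) / Gamma \<alpha> - s powr (\<alpha> - 1) * ml_resolvent \<alpha> (s powr \<alpha>))"
  have D: "D s = s powr (2 * \<alpha> - 1) * ml_resolvent_slope \<alpha> (s powr \<alpha>)" if "s > 0" for s
    unfolding D_def ml_resolvent_slope_def b_def[symmetric] using frac_series_eq[of \<alpha> "2 * \<alpha>" b 2 s] that \<alpha> b
    by (simp add: b_def)
  have "D T > 0"
  proof (rule volterra_positive_step[OF \<alpha> T(1), where g = g])
    have "continuous_on {0<..T} (\<lambda>s. s powr (2 * \<alpha> - 1) * ml_resolvent_slope \<alpha> (s powr \<alpha>))"
      by (intro continuous_intros continuous_on_compose2[OF cont]) auto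
    then show "continuous_on {0<..T} D"
      by (rule continuous_on_eq) (simp add: D)
    show "D s > 0" if "0 < s" "s < T" for s
    proof -
      have "s powr \<alpha> < X" using powr_less_mono2[of \<alpha> s T] that \<alpha> T by simp
      then show ?thesis using that pos[of "s powr \<alpha>"] by (simp add: D)
    qed
    show "((\<lambda>s. (t - s) powr (\<alpha> - 1) / Gamma \<alpha> * D s) has_integral g t - D t) {0..t}"
      if t: "0 < t" "t \<le> T" for t
    proof -
      let ?e = "\<lambda>k::nat. (- 1 :: real) ^ k"
      let ?F = "frac_series \<alpha>"
      have "g t = t powr (\<alpha> - 1) / Gamma \<alpha> - ?F \<alpha> ?e t"
        unfolding g_def ml_resolvent_def using frac_series_eq[of \<alpha> \<alpha> ?e 1 t] t \<alpha> by simp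
      also have "\<dots> = ?F (2 * \<alpha>) ?e t"
        using frac_series_split_head[of \<alpha> \<alpha> ?e 1 t] t \<alpha> frac_series_minus[of \<alpha> "2 * \<alpha>" ?e 1 t]
        by simp
      finally have g: "g t = ?F (2 * \<alpha>) ?e t" .
      have le: "\<bar>?e k * real k\<bar> \<le> 2 ^ k" for k
        using b[of k] by (simp add: b_def abs_mult)
      \<comment> \<open>Writing k + 1 as 1 plus k isolates \<open>g\<close>; the remaining series
        has zero head, and its shifted coefficients are again \<open>- b k\<close>.\<close>
      have "?F (2 * \<alpha>) b t = ?F (2 * \<alpha>) (\<lambda>k. ?e k + ?e k * real k) t"
        by (simp add: b_def algebra_simps)
      also have "\<dots> = ?F (2 * \<alpha>) ?e t + ?F (2 * \<alpha>) (\<lambda>k. ?e k * real k) t"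
        using t \<alpha> le by (intro frac_series_add[where M = 1 and N = 2]) auto
      also have "?F (2 * \<alpha>) (\<lambda>k. ?e k * real k) t = ?F (3 * \<alpha>) (\<lambda>k. - b k) t"
        using frac_series_split_head[of \<alpha> "2 * \<alpha>" "\<lambda>k. ?e k * real k" 2 t] t \<alpha> le
        by (simp add: b_def)
      also have "\<dots> = - ?F (3 * \<alpha>) b t"
        using t \<alpha> b by (intro frac_series_minus[where M = 2]) auto
      finally have "g t - D t = ?F (\<alpha> + 2 * \<alpha>) b t" by (simp add: g D_def)
      then show ?thesis
        using has_integral_frac_series[of \<alpha> "2 * \<alpha>" \<alpha> t b 2] t \<alpha> b by (simp add: D_def)
    qed
    show "g t / (t powr (\<alpha> - 1) / Gamma \<alpha>) \<le> g T / (T powr (\<alpha> - 1) / Gamma \<alpha>)"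
      if t: "0 < t" "t \<le> T" for t
    proof -
      have "ml_resolvent \<alpha> (T powr \<alpha>) \<le> ml_resolvent \<alpha> (t powr \<alpha>)"
      \<comment> \<open>The derivative test on the open interval is essential: the sign of the slope
        at \<open>X\<close> itself is the goal.\<close>
      proof (rule DERIV_nonpos_imp_decreasing_open[where f = "ml_resolvent \<alpha>"])
        show "t powr \<alpha> \<le> T powr \<alpha>" using t \<alpha> by (intro powr_mono2) auto
        show "\<exists>y. (ml_resolvent \<alpha> has_real_derivative y) (at z) \<and> y \<le> 0"
          if "t powr \<alpha> < z" "z < T powr \<alpha>" for z
          using DERIV_ml_resolvent[OF \<alpha>(1), of z] pos[of z] that T t powr_ge_zero[of t \<alpha>] 
          by (intro exI[of _ "- ml_resolvent_slope \<alpha> z"]) auto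
        show "continuous_on {t powr \<alpha>..T powr \<alpha>} (ml_resolvent \<alpha>)"
          by (intro continuous_at_imp_continuous_on ballI DERIV_isCont[OF DERIV_ml_resolvent[OF \<alpha>(1)]])
      qed
      moreover have "g s / (s powr (\<alpha> - 1) / Gamma \<alpha>) = 1 - Gamma \<alpha> * ml_resolvent \<alpha> (s powr \<alpha>)"
        if "s > 0" for s
        using that \<Gamma> by (simp add: g_def field_simps)
      ultimately show ?thesis using t T \<Gamma> by simp
    qed
  qed
  then show "ml_resolvent_slope \<alpha> X > 0" using D[OF T(1)] T by (simp add: zero_less_mult_iff)
qed

lemma ml_resolvent_antimono:
  assumes \<alpha>: "0 < \<alpha>" "\<alpha> < 1" and "0 \<le> x" "x \<le> y"
  shows "ml_resolvent \<alpha> y \<le> ml_resolvent \<alpha> x"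
  using ml_resolvent_slope_pos[OF \<alpha>] assms DERIV_ml_resolvent[OF \<alpha>(1)]
  by (intro DERIV_nonpos_imp_nonincreasing[OF \<open>x \<le> y\<close>]) (meson le_less neg_le_0_iff_le order_trans)

section \<open>Discrete Caputo derivative and comparison\<close>

text \<open>Chebyshev's inequality: with \<open>z\<close> a mean value point of \<open>P\<close>,
  integrate (p s - p z)(q s - q z) \<le> 0; the terms with \<open>q z\<close> cancel. Monotonicity
  is asked only in the interior, since the weight is singular at the last grid point and r at
  0.\<close>

lemma integral_mult_le_opposite_monotone:
  fixes p q P :: "real \<Rightarrow> real"
  assumes "a < b" and P: "continuous_on {a..b} P"
    and dP: "\<And>s. a < s \<Longrightarrow> s < b \<Longrightarrow> (P has_real_derivative p s) (at s)"
    and p: "\<And>x y. a < x \<Longrightarrow> x \<le> y \<Longrightarrow> y < b \<Longrightarrow> p x \<le> p y"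
    and q: "\<And>x y. a < x \<Longrightarrow> x \<le> y \<Longrightarrow> y < b \<Longrightarrow> q y \<le> q x"
    and Q: "(q has_integral Q) {a..b}" and R: "((\<lambda>s. p s * q s) has_integral R) {a..b}"
  shows "(b - a) * R \<le> (P b - P a) * Q"
proof -
  have Pp: "(p has_integral P b - P a) {a..b}"
    using fundamental_theorem_of_calculus_interior[of a b P p] assms
    by (auto simp: has_real_derivative_iff_has_vector_derivative)
  have "\<exists>l z. a < z \<and> z < b \<and> DERIV P z :> l \<and> P b - P a = (b - a) * l"
    using \<open>a < b\<close> P by (rule MVT) (use dP in \<open>auto simp: real_differentiable_def\<close>)
  then obtain z where z: "a < z" "z < b" "P b - P a = (b - a) * p z"
    using dP DERIV_unique by metis
  have "((\<lambda>s. p z * q s + q z * p s - p z * q z) has_integral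
      p z * Q + q z * (P b - P a) - (b - a) * (p z * q z)) {a..b}"
    using has_integral_const_real[of "p z * q z" a b] \<open>a < b\<close>
    by (intro has_integral_diff has_integral_add has_integral_mult_right Q Pp) simp
  moreover have "p s * q s \<le> p z * q s + q z * p s - p z * q z" if "s \<in> {a<..<b}" for s
  proof -
    have "(p s - p z) * (q s - q z) \<le> 0"
      using p[of s z] p[of z s] q[of s z] q[of z s] z that
      by (cases "s \<le> z") (auto simp: mult_le_0_iff)
    then show ?thesis by (simp add: algebra_simps)
  qed
  ultimately have "R \<le> p z * Q + q z * (P b - P a) - (b - a) * (p z * q z)"
    using R unfolding has_integral_Icc_iff_Ioo by (auto intro: has_integral_le)
  also have "\<dots> = p z * Q" using z by simp
  finally show ?thesis using z \<open>a < b\<close> by (simp add: mult_left_mono mult.assoc)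
qed

text \<open>\<open>J\<close> is the Caputo derivative of \<open>w\<close>, as \<open>r\<close> is
  the derivative of \<open>w\<close>. Interval by interval, Chebyshev bounds its contribution by the
  mean weight times the increment of \<open>w\<close>, and the kernel dominates \<nu> times that
  mean.\<close>

lemma discrete_caputo_ge:
  fixes \<alpha> \<nu> :: real and t :: "nat \<Rightarrow> real" and w r J :: "real \<Rightarrow> real"
  assumes \<alpha>: "0 < \<alpha>" "\<alpha> < 1" and t: "t 0 = 0" "strict_mono t"
    and \<nu>: "\<nu> > 0" and C: "kernel_lower_bound \<alpha> t \<nu> C"
    and r_nonneg: "\<And>s. s > 0 \<Longrightarrow> r s \<ge> 0"
    and r_antimono: "\<And>x y. 0 < x \<Longrightarrow> x \<le> y \<Longrightarrow> r y \<le> r x"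
    and w: "\<And>T. T > 0 \<Longrightarrow> (r has_integral w T - w 0) {0..T}"
    and J: "\<And>T. T > 0 \<Longrightarrow> ((\<lambda>s. frac_weight \<alpha> (T - s) * r s) has_integral J T) {0..T}"
    and n: "n \<ge> 1"
  shows "\<nu> * J (t n) \<le> discrete_frac_deriv C (\<lambda>j. w (t j)) n"
proof -
  have t_mono: "t i \<le> t j" if "i \<le> j" for i j using t(2) that by (simp add: strict_mono_less_eq)
  have t_nonneg: "0 \<le> t j" for j using t_mono[of 0 j] t(1) by simp
  have tn: "t n > 0" using strict_monoD[OF t(2), of 0 n] n t(1) by simp
  have \<Gamma>: "Gamma (1 - \<alpha>) > 0" using \<alpha> by (simp add: Gamma_real_pos)
  define p where "p = (\<lambda>s. frac_weight \<alpha> (t n - s))"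
  define f where "f = (\<lambda>s. p s * r s)"
  have f: "f integrable_on {0..t n}" "integral {0..t n} f = J (t n)"
    using J[OF tn] by (auto simp: f_def p_def integral_unique)
  have fsub: "f integrable_on {a..b}" if "0 \<le> a" "b \<le> t n" for a b
    by (rule integrable_subinterval_real[OF f(1)]) (use that in auto)
  have "(\<Sum>j=1..m. integral {t (j - 1)..t j} f) = integral {0..t m} f" if "m \<le> n" for m
    using that
  proof (induction m)
    case (Suc m)
    then show ?case
      using Henstock_Kurzweil_Integration.integral_combine[of 0 "t m" "t (Suc m)" f] t_nonneg[of m] t_mono[of m "Suc m"] t_mono[of "Suc m" n] fsub[of 0 "t (Suc m)"]
      by simp
  qed (simp add: t)
  then have "J (t n) = (\<Sum>j=1..n. integral {t (j - 1)..t j} f)" using f by simp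
  then have "\<nu> * J (t n) = (\<Sum>j=1..n. \<nu> * integral {t (j - 1)..t j} f)"
    by (simp add: sum_distrib_left)
  also have "\<dots> \<le> (\<Sum>j=1..n. C n (n - j) * (w (t j) - w (t (j - 1))))"
  proof (rule sum_mono)
    fix j assume j: "j \<in> {1..n}"
    define a where "a = t (j - 1)"
    define b where "b = t j"
    \<comment> \<open>An antiderivative of the weight that stays continuous at \<open>t n\<close>,
      because 1 - \<alpha> > 0.\<close>
    define P where "P = (\<lambda>s. - ((t n - s) powr (1 - \<alpha>) / ((1 - \<alpha>) * Gamma (1 - \<alpha>))))"
    have ab: "0 \<le> a" "a < b" "b \<le> t n"
      using j t_nonneg t_mono[of j n] strict_monoD[OF t(2), of "j - 1" j] by (auto simp: a_def b_def)
    have contP: "continuous_on {a..b} P"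
      unfolding P_def divide_inverse using ab \<alpha>
      by (intro continuous_on_minus continuous_on_mult_right continuous_on_powr' continuous_intros) auto
    have dP: "(P has_real_derivative p s) (at s)" if "a < s" "s < b" for s
    proof -
      have "((\<lambda>s. (t n - s) powr (1 - \<alpha>)) has_real_derivative - ((1 - \<alpha>) * (t n - s) powr (- \<alpha>))) (at s)"
        using that ab by (auto intro!: derivative_eq_intros)
      from DERIV_minus[OF DERIV_cdivide[OF this, of "(1 - \<alpha>) * Gamma (1 - \<alpha>)"]] show ?thesis
        using \<alpha> by (simp add: P_def p_def frac_weight_def)
    qed
    have intp: "integral {a..b} p = P b - P a"
      using fundamental_theorem_of_calculus_interior[OF _ contP, of p] dP ab
      by (auto simp: has_real_derivative_iff_has_vector_derivative intro!: integral_unique)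
    have Q: "(r has_integral w b - w a) {a..b}"
    proof (cases "a = 0")
      case True
      then show ?thesis using w[of b] ab by simp
    next
      case False
      have "r integrable_on {0..b}" using w[of b] ab by auto
      then have "r integrable_on {a..b}" "integral {0..a} r + integral {a..b} r = integral {0..b} r"
        using ab Henstock_Kurzweil_Integration.integral_combine[of 0 a b r]
        by (auto intro: integrable_subinterval_real)
      then show ?thesis
        using w[of a] w[of b] ab False by (simp add: has_integral_iff)
    qed
    \<comment> \<open>The kernel bound may be multiplied by the increment only because of this
      sign.\<close>
    have "w b - w a \<ge> 0"
      using Q unfolding has_integral_Icc_iff_Ioo
      by (rule has_integral_nonneg) (use r_nonneg ab in auto)
    moreover have "C n (n - j) \<ge> \<nu> * (1 / (b - a) * integral {a..b} p)"
      using C j n unfolding kernel_lower_bound_def step_size_def a_def b_def p_def by auto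
    then have "C n (n - j) \<ge> \<nu> * (1 / (b - a) * (P b - P a))"
      by (simp only: intp)
    ultimately have "C n (n - j) * (w b - w a) \<ge> \<nu> * (1 / (b - a) * (P b - P a)) * (w b - w a)"
      by (rule mult_right_mono[rotated])
    moreover have "(b - a) * integral {a..b} f \<le> (P b - P a) * (w b - w a)"
    proof (rule integral_mult_le_opposite_monotone[OF ab(2) contP dP _ _ Q])
      show "((\<lambda>s. p s * r s) has_integral integral {a..b} f) {a..b}"
        using integrable_integral[OF fsub] ab by (simp add: f_def)
      show "p x \<le> p y" if "a < x" "x \<le> y" "y < b" for x y
        unfolding p_def frac_weight_def using that ab \<alpha> \<Gamma>
        by (intro divide_right_mono powr_mono2') auto
    qed (use r_antimono ab in auto)
    then have "integral {a..b} f \<le> 1 / (b - a) * (P b - P a) * (w b - w a)"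
      using ab by (simp add: field_simps)
    then have "\<nu> * integral {a..b} f \<le> \<nu> * (1 / (b - a) * (P b - P a) * (w b - w a))"
      using \<nu> by (intro mult_left_mono) auto
    ultimately show "\<nu> * integral {t (j - 1)..t j} f \<le> C n (n - j) * (w (t j) - w (t (j - 1)))"
      by (simp add: a_def b_def mult.assoc)
  qed
  finally show ?thesis by (simp add: discrete_frac_deriv_def)
qed

section \<open>Abel summation and the discrete comparison principle\<close>

lemma discrete_frac_deriv_summation_by_parts:
  assumes "1 \<le> n"
  shows "discrete_frac_deriv C u n = (\<Sum>j=1..n. kernel_diff C n (n - j) * u j) - C n (n - 1) * u 0"
proof -
  have "(\<Sum>j=1..m. C n (n - j) * (u j - u (j - 1)))
      = C n (n - m) * u m + (\<Sum>j=1..<m. (C n (n - j) - C n (n - j - 1)) * u j) - C n (n - 1) * u 0"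
    if "1 \<le> m" for m
    using that by (induction m rule: dec_induct) (simp_all add: algebra_simps)
  from this[of n] assms
  have "discrete_frac_deriv C u n
      = C n 0 * u n + (\<Sum>j=1..<n. (C n (n - j) - C n (n - j - 1)) * u j) - C n (n - 1) * u 0"
    by (simp add: discrete_frac_deriv_def)
  also have "(\<Sum>j=1..<n. (C n (n - j) - C n (n - j - 1)) * u j) = (\<Sum>j=1..<n. kernel_diff C n (n - j) * u j)"
    by (intro sum.cong) (auto simp: kernel_diff_def)
  also have "C n 0 * u n + \<dots> = (\<Sum>j=1..n. kernel_diff C n (n - j) * u j)"
    using assms by (simp add: sum.last_plus kernel_diff_def)
  finally show ?thesis .
qed

text \<open>By strong induction the earlier values are nonpositive, as are their coefficients, so
  their sum is nonnegative and the positive diagonal entry forces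
  \<open>u n \<le> 0\<close>.\<close>

lemma discrete_comparison:
  assumes C: "completely_positive C" and "lam \<ge> 0" and "u 0 = 0"
    and u: "\<And>n. n \<ge> 1 \<Longrightarrow> discrete_frac_deriv C u n \<le> - lam * u n"
  shows "u n \<le> 0"
proof (induction n rule: less_induct)
  case (less n)
  show ?case
  proof (cases "n = 0")
    case False
    then have n: "n \<ge> 1" by simp
    have b: "kernel_diff C n 0 > 0" "\<And>j. 1 \<le> j \<Longrightarrow> j < n \<Longrightarrow> kernel_diff C n (n - j) \<le> 0"
      using C n unfolding completely_positive_def by auto
    have "0 \<le> (\<Sum>j=1..<n. kernel_diff C n (n - j) * u j)"
      using b less by (intro sum_nonneg mult_nonpos_nonpos) auto
    moreover have "discrete_frac_deriv C u n = kernel_diff C n 0 * u n + (\<Sum>j=1..<n. kernel_diff C n (n - j) * u j)"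
      using discrete_frac_deriv_summation_by_parts[OF n, of C u] \<open>u 0 = 0\<close> n by (simp add: sum.last_plus)
    ultimately have "(kernel_diff C n 0 + lam) * u n \<le> 0"
      using u[OF n] by (simp add: algebra_simps)
    then show ?thesis using b(1) \<open>lam \<ge> 0\<close> by (simp add: mult_le_0_iff)
  qed (use \<open>u 0 = 0\<close> in simp)
qed

section \<open>Comparison of \<open>v\<close> with the continuous solution\<close>

theorem theorem4p1:
  fixes \<alpha> \<nu> lam c :: real
    and t v :: "nat \<Rightarrow> real"
    and C :: "nat \<Rightarrow> nat \<Rightarrow> real"
  assumes "0 < \<alpha>" and "\<alpha> < 1"
    and "t 0 = 0" and "strict_mono t"
    and "completely_positive C"
    and "\<nu> > 0" and "kernel_lower_bound \<alpha> t \<nu> C"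
    and "\<And>n. v n \<ge> 0"
    and "lam \<ge> 0"
    and "\<And>n. n \<ge> 1 \<Longrightarrow> discrete_frac_deriv C v n \<le> - lam * v n + c"
  shows "(lam > 0 \<and> v 0 \<le> c / lam \<longrightarrow>
            (\<forall>n. v n \<le> (v 0 - c / lam) * mittag_leffler \<alpha> (- (inverse \<nu> * lam * t n powr \<alpha>)) + c / lam))
       \<and> (lam = 0 \<and> v 0 \<ge> 0 \<and> c \<ge> 0 \<longrightarrow>
            (\<forall>n. v n \<le> v 0 + inverse \<nu> * c * (1 / Gamma (1 + \<alpha>)) * t n powr \<alpha>))"
proof -
  note \<alpha> = \<open>0 < \<alpha>\<close> \<open>\<alpha> < 1\<close>
  define \<mu> where "\<mu> = lam / \<nu>"
  define A where "A = (c - lam * v 0) / \<nu>"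
  have \<mu>: "\<mu> \<ge> 0" using assms by (simp add: \<mu>_def)
  let ?e = "\<lambda>k::nat. (- \<mu>) ^ k"
  have e: "\<bar>?e k\<bar> \<le> \<mu> ^ k" for k using \<mu> by (simp add: power_abs)
  \<comment> \<open>For positive arguments \<open>F \<alpha>\<close> is r,
    \<open>F (1 + \<alpha>)\<close> is \<Phi>, and \<open>F 1\<close> is E_\<alpha>(-\<mu>
    s^\<alpha>), the Caputo derivative of \<Phi>.\<close>
  define F where "F = (\<lambda>\<beta>. frac_series \<alpha> \<beta> ?e)"
  have F1: "F 1 T = 1 - \<mu> * F (1 + \<alpha>) T" if "T > 0" for T
    using frac_series_split_head[of \<alpha> 1 ?e \<mu> T] frac_series_cmult[of \<alpha> "1 + \<alpha>" ?e \<mu> T "- \<mu>"] that \<alpha> e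
    by (simp add: F_def add.commute)
  have r: "F \<alpha> s = s powr (\<alpha> - 1) * ml_resolvent \<alpha> (\<mu> * s powr \<alpha>)" if "s > 0" for s
  proof -
    have "?e k = (- 1) ^ k * \<mu> ^ k" for k by (metis mult_minus1 power_mult_distrib)
    then show ?thesis
      using frac_series_eq[of \<alpha> \<alpha> ?e \<mu> s] that \<alpha> e
      by (simp add: F_def ml_resolvent_def power_mult_distrib mult_ac)
  qed
  have r_pos: "F \<alpha> s \<ge> 0" if "s > 0" for s
    using r[OF that] ml_resolvent_pos[OF \<alpha>, of "\<mu> * s powr \<alpha>"] \<mu> by simp
  have r_antimono: "F \<alpha> y \<le> F \<alpha> x" if "0 < x" "x \<le> y" for x y
  proof -
    have "y powr (\<alpha> - 1) * ml_resolvent \<alpha> (\<mu> * y powr \<alpha>) \<le> x powr (\<alpha> - 1) * ml_resolvent \<alpha> (\<mu> * x powr \<alpha>)"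
      using that \<alpha> \<mu> ml_resolvent_pos[OF \<alpha>, of "\<mu> * y powr \<alpha>"]
      by (intro mult_mono powr_mono2' ml_resolvent_antimono mult_left_mono powr_mono2) auto
    then show ?thesis using that by (simp add: r)
  qed
  have int_r: "(F \<alpha> has_integral F (1 + \<alpha>) T) {0..T}" if "T > 0" for T
  \<comment> \<open>Fractional integration of order 1: the kernel is 1 except at
    \<open>s = T\<close>, where \<open>0 powr 0 = 0\<close>.\<close>
  proof (rule has_integral_spike_finite[where S = "{T}"])
    show "((\<lambda>s. (T - s) powr (1 - 1) / Gamma 1 * F \<alpha> s) has_integral F (1 + \<alpha>) T) {0..T}"
      unfolding F_def by (rule has_integral_frac_series[OF _ _ _ _ e]) (use \<alpha> that in auto)
  qed (use that in auto)
  have caputo_r: "((\<lambda>s. frac_weight \<alpha> (T - s) * F \<alpha> s) has_integral F 1 T) {0..T}" if "T > 0" for T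
    using has_integral_frac_series[OF \<alpha>(1) \<alpha>(1) _ that e, of "1 - \<alpha>"] \<alpha>
    by (simp add: F_def frac_weight_def)
  define w where "w = (\<lambda>T. v 0 + A * F (1 + \<alpha>) T)"
  have F0: "F (1 + \<alpha>) 0 = 0" by (simp add: F_def frac_series_def)
  \<comment> \<open>The sign of \<open>A\<close> makes the derivative
    \<open>A * F \<alpha> s\<close> of \<open>w\<close> nonnegative and nonincreasing.\<close>
  have bound: "v n \<le> w (t n)" if "A \<ge> 0" for n
  proof -
    define u where "u = (\<lambda>n. v n - w (t n))"
    have "u n \<le> 0"
    proof (rule discrete_comparison[OF \<open>completely_positive C\<close> \<open>lam \<ge> 0\<close>])
      show "u 0 = 0" by (simp add: u_def w_def F0 \<open>t 0 = 0\<close>)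
      fix n :: nat assume n: "n \<ge> 1"
      have tn: "t n > 0" using strict_monoD[OF \<open>strict_mono t\<close>, of 0 n] n \<open>t 0 = 0\<close> by simp
      have "\<nu> * (A * F 1 (t n)) \<le> discrete_frac_deriv C (\<lambda>j. w (t j)) n"
      proof (rule discrete_caputo_ge[where r = "\<lambda>s. A * F \<alpha> s" and J = "\<lambda>T. A * F 1 T"])
        show "((\<lambda>s. A * F \<alpha> s) has_integral w T - w 0) {0..T}" if "T > 0" for T
          using has_integral_mult_right[OF int_r[OF that], of A] by (simp add: w_def F0)
        show "((\<lambda>s. frac_weight \<alpha> (T - s) * (A * F \<alpha> s)) has_integral A * F 1 T) {0..T}" if "T > 0" for T
          using has_integral_mult_right[OF caputo_r[OF that], of A] by (simp add: mult_ac)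
      qed (use assms n that r_pos r_antimono in \<open>auto intro: mult_left_mono\<close>)
      moreover have "\<nu> * (A * F 1 (t n)) = - lam * w (t n) + c"
      proof -
        have "\<nu> * A = c - lam * v 0" "\<nu> * \<mu> = lam" using \<open>\<nu> > 0\<close> by (simp_all add: A_def \<mu>_def)
        then show ?thesis unfolding F1[OF tn] w_def by algebra
      qed
      moreover have "discrete_frac_deriv C u n = discrete_frac_deriv C v n - discrete_frac_deriv C (\<lambda>j. w (t j)) n"
        by (simp add: discrete_frac_deriv_def u_def sum_subtractf[symmetric] algebra_simps)
      ultimately show "discrete_frac_deriv C u n \<le> - lam * u n"
        using assms(10)[OF n] by (simp add: u_def algebra_simps)
    qed
    then show ?thesis by (simp add: u_def)
  qed
  have t_nonneg: "t n \<ge> 0" for n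
    using \<open>t 0 = 0\<close> \<open>strict_mono t\<close> by (metis le0 strict_mono_less_eq)
  have ml: "mittag_leffler \<alpha> (- (inverse \<nu> * lam * t n powr \<alpha>)) = 1 - \<mu> * F (1 + \<alpha>) (t n)" for n
  \<comment> \<open>At 0 the series \<open>F 1\<close> gives 0 instead of E_\<alpha>(0) = 1, so this
    point is treated apart.\<close>
  proof (cases "t n = 0")
    case True
    then show ?thesis
      using powser_zero[of "\<lambda>k. 1 / Gamma (\<alpha> * real k + 1)"] \<alpha> by (simp add: mittag_leffler_def F0)
  next
    case False
    then have tn: "t n > 0" using t_nonneg[of n] by simp
    have "(- (inverse \<nu> * lam * t n powr \<alpha>)) ^ k = ?e k * t n powr (\<alpha> * real k)" for k
      using tn by (simp add: \<mu>_def powr_powr[symmetric] powr_realpow power_mult_distrib[symmetric] divide_inverse mult_ac)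
    then have "mittag_leffler \<alpha> (- (inverse \<nu> * lam * t n powr \<alpha>)) = F 1 (t n)"
      by (simp add: mittag_leffler_def F_def frac_series_def)
    then show ?thesis using F1[OF tn] by simp
  qed
  show ?thesis
  proof (intro conjI impI allI; elim conjE)
    fix n assume "lam > 0" "v 0 \<le> c / lam"
    then have "A \<ge> 0" using \<open>\<nu> > 0\<close> by (simp add: A_def field_simps)
    \<comment> \<open>This turns the Mittag-Leffler bound into
      \<open>v 0 + A * F (1 + \<alpha>) (t n)\<close>.\<close>
    have "(v 0 - c / lam) * \<mu> = - A"
      using \<open>lam > 0\<close> \<open>\<nu> > 0\<close> by (simp add: A_def \<mu>_def field_simps)
    then have "(v 0 - c / lam) * (1 - \<mu> * F (1 + \<alpha>) (t n)) + c / lam = w (t n)"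
      unfolding w_def by algebra
    then show "v n \<le> (v 0 - c / lam) * mittag_leffler \<alpha> (- (inverse \<nu> * lam * t n powr \<alpha>)) + c / lam"
      unfolding ml using bound[OF \<open>A \<ge> 0\<close>, of n] by simp
  next
    fix n assume "lam = 0" "v 0 \<ge> 0" "c \<ge> 0"
    then have "A \<ge> 0" using \<open>\<nu> > 0\<close> by (simp add: A_def)
    \<comment> \<open>With \<mu> = 0 only the term of index 0 survives.\<close>
    have "F (1 + \<alpha>) (t n) = t n powr \<alpha> / Gamma (1 + \<alpha>)"
      using \<open>lam = 0\<close> powser_zero[of "\<lambda>k. t n powr (\<alpha> * real k + (1 + \<alpha>) - 1) / Gamma (\<alpha> * real k + (1 + \<alpha>))"]
      by (simp add: F_def frac_series_def \<mu>_def mult.commute)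
    then show "v n \<le> v 0 + inverse \<nu> * c * (1 / Gamma (1 + \<alpha>)) * t n powr \<alpha>"
      using bound[OF \<open>A \<ge> 0\<close>, of n] \<open>lam = 0\<close> by (simp add: w_def A_def field_simps)
  qed
qed

end
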